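(* Let $X_n$, $n\ge1$, be a stationary sequence of centered real random variables that is L-weakly dependent with coefficients $\gamma_k$, $k\geq 1$, and suppose there exists $c>0$ such that $|X_n|\le c$ almost surely for every $n\ge1$. Let $S_n=X_1+\cdots+X_n$ and assume that $\frac1n\mathbb{E}S_n^2\to\sigma^2$ as $n\to\infty$ for some $\sigma^2\in(0,\infty)$. Assume that $v(n)=\sum_{k=n}^\infty\gamma_k$ satisfies $v(n)=O(\rho^n)$ for some $\rho\in(0,1)$. Then $\frac1nS_n\to0$ almost surely with convergence rate $\frac{\log n}{n^{1/2-\delta}}$, where $\delta>0$ is arbitrarily small; that is, for every $\delta>0$, almost surely $\frac1n S_n=O\left(\frac{\log n}{n^{1/2-\delta}}\right)$ as $n\to\infty$.
   Context: Stationary means strictly stationary. L-weak dependence: real random variables $X_n$, $n\ge1$, are L-weakly dependent with nonnegative coefficients $\gamma_k$, $k\ge1$, if $\sum_{k\ge1}\gamma_k<\infty$ and for all disjoint finite subsets $I,J\subset\{1,2,\ldots\}$ and all real valued Lipschitz functions $f:\mathbb{R}^I\to\mathbb{R}$, $g:\mathbb{R}^J\to\mathbb{R}$, the covariance below is well defined and $$|\mathrm{Cov}(f(X_i,i\in I),g(X_j,j\in J))|\le \|f\|_L\|g\|_L\sum_{i\in I}\sum_{j\in J}\gamma_{|j-i|},$$ where $\|f\|_L=\sup_{x\neq y}\frac{|f(x)-f(y)|}{|x-y|}$ and $|x-y|=\sum_i|x_i-y_i|$ is the $\ell^1$ distance. *)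

theory Defs
  imports "HOL-Probability.Probability" "HOL-Library.Landau_Symbols"
begin

text \<open>
  For a finite index set \<open>I\<close>, the space of real vectors indexed by \<open>I\<close> is represented by the
  extensional functions \<open>I \<rightarrow>\<^sub>E UNIV\<close>, which is also the space of \<open>PiM I (\<lambda>_. borel)\<close>.
  It carries the \<open>\<ell>\<^sup>1\<close> distance, not the product metric of the library's function type.
\<close>

definition l1_dist :: "nat set \<Rightarrow> (nat \<Rightarrow> real) \<Rightarrow> (nat \<Rightarrow> real) \<Rightarrow> real" where
  "l1_dist I x y = (\<Sum>i\<in>I. \<bar>x i - y i\<bar>)"

definition l1_lipschitz :: "nat set \<Rightarrow> ((nat \<Rightarrow> real) \<Rightarrow> real) \<Rightarrow> bool" where
  "l1_lipschitz I f \<longleftrightarrow>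
     (\<exists>L. \<forall>x \<in> I \<rightarrow>\<^sub>E UNIV. \<forall>y \<in> I \<rightarrow>\<^sub>E UNIV. \<bar>f x - f y\<bar> \<le> L * l1_dist I x y)"

text \<open>
  The inserted \<open>0\<close> only matters for \<open>I = {}\<close>, where there are no two distinct points:
  the supremum of the empty family is then \<open>0\<close> instead of an unspecified real.
  The value is meaningful only for functions satisfying \<^const>\<open>l1_lipschitz\<close>.
\<close>

definition l1_lip_norm :: "nat set \<Rightarrow> ((nat \<Rightarrow> real) \<Rightarrow> real) \<Rightarrow> real" where
  "l1_lip_norm I f =
     Sup (insert 0 {\<bar>f x - f y\<bar> / l1_dist I x y | x y.
                      x \<in> I \<rightarrow>\<^sub>E UNIV \<and> y \<in> I \<rightarrow>\<^sub>E UNIV \<and> x \<noteq> y})"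

definition covariance_defined :: "'a measure \<Rightarrow> ('a \<Rightarrow> real) \<Rightarrow> ('a \<Rightarrow> real) \<Rightarrow> bool" where
  "covariance_defined M Y Z \<longleftrightarrow>
     integrable M Y \<and> integrable M Z \<and> integrable M (\<lambda>\<omega>. Y \<omega> * Z \<omega>)"

definition covariance :: "'a measure \<Rightarrow> ('a \<Rightarrow> real) \<Rightarrow> ('a \<Rightarrow> real) \<Rightarrow> real" where
  "covariance M Y Z =
     integral\<^sup>L M (\<lambda>\<omega>. (Y \<omega> - integral\<^sup>L M Y) * (Z \<omega> - integral\<^sup>L M Z))"

text \<open>
  Sequences are indexed by the positive integers: the values \<open>X 0\<close> and \<open>\<gamma> 0\<close> are never used.
\<close>

definition L_weakly_dependent ::
    "'a measure \<Rightarrow> (nat \<Rightarrow> 'a \<Rightarrow> real) \<Rightarrow> (nat \<Rightarrow> real) \<Rightarrow> bool" where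
  "L_weakly_dependent M X \<gamma> \<longleftrightarrow>
     (\<forall>k\<ge>1. 0 \<le> \<gamma> k) \<and>
     summable (\<lambda>k. \<gamma> (Suc k)) \<and>
     (\<forall>I J f g.
        finite I \<and> finite J \<and> I \<subseteq> {1..} \<and> J \<subseteq> {1..} \<and> I \<inter> J = {} \<and>
        l1_lipschitz I f \<and> l1_lipschitz J g \<longrightarrow>
          covariance_defined M (\<lambda>\<omega>. f (\<lambda>i\<in>I. X i \<omega>)) (\<lambda>\<omega>. g (\<lambda>j\<in>J. X j \<omega>)) \<and>
          \<bar>covariance M (\<lambda>\<omega>. f (\<lambda>i\<in>I. X i \<omega>)) (\<lambda>\<omega>. g (\<lambda>j\<in>J. X j \<omega>))\<bar>
            \<le> l1_lip_norm I f * l1_lip_norm J g *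
               (\<Sum>i\<in>I. \<Sum>j\<in>J. \<gamma> (nat \<bar>int j - int i\<bar>)))"

text \<open>
  Strict stationarity: all finite-dimensional distributions are invariant under shifts.
\<close>

definition strictly_stationary :: "'a measure \<Rightarrow> (nat \<Rightarrow> 'a \<Rightarrow> real) \<Rightarrow> bool" where
  "strictly_stationary M X \<longleftrightarrow>
     (\<forall>I h. finite I \<and> I \<subseteq> {1..} \<longrightarrow>
        distr M (PiM I (\<lambda>_. borel)) (\<lambda>\<omega>. \<lambda>i\<in>I. X (i + h) \<omega>) =
        distr M (PiM I (\<lambda>_. borel)) (\<lambda>\<omega>. \<lambda>i\<in>I. X i \<omega>))"

end

theory Submission
  imports Defs "HOL-Real_Asymp.Real_Asymp"
begin

text \<open>
  The coordinate functions are 1-Lipschitz, so weak dependence bounds the correlations by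
  \<open>\<bar>E X\<^sub>i X\<^sub>j\<bar> \<le> \<gamma> \<bar>i - j\<bar>\<close>. As \<open>\<gamma>\<close> is summable, every block of \<open>n\<close> consecutive variables has a sum
  with second moment at most \<open>C n\<close>. The dyadic maximal inequality of Rademacher and Menshov turns
  this into \<open>E (max\<^bsub>n \<le> 2^r\<^esub> S\<^sub>n\<^sup>2) \<le> C (r + 1)\<^sup>2 2\<^sup>r\<close>. Dividing by \<open>2\<^bsup>r (1 + \<epsilon>)\<^esup>\<close> gives a convergent
  series in \<open>r\<close>, hence \<open>S\<^sub>n = O(n\<^bsup>(1 + \<epsilon>)/2\<^esup>)\<close> almost surely.
\<close>

section \<open>Dyadic maximal inequality\<close>

text \<open>Halve the block of \<open>2 ^ r\<close> indices from \<open>m\<close> on repeatedly down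
  to single indices. Every halving contributes the squared sum over its left half, and every single
  index its squared term. These are the pieces from which all initial segments of the block can be
  assembled.\<close>

primrec dyadic_energy :: "(nat \<Rightarrow> real) \<Rightarrow> nat \<Rightarrow> nat \<Rightarrow> real" where
  "dyadic_energy x 0 m = (x m)\<^sup>2"
| "dyadic_energy x (Suc r) m =
     (\<Sum>i\<in>{m..<m + 2 ^ r}. x i)\<^sup>2 + dyadic_energy x r m + dyadic_energy x r (m + 2 ^ r)"

lemma dyadic_energy_nonneg: "0 \<le> dyadic_energy x r m"
  by (induction r arbitrary: m) auto

text \<open>The free weight keeps the factor in the following induction linear in \<open>r\<close>;
  the unweighted bound \<open>2 * a\<^sup>2 + 2 * b\<^sup>2\<close> would double it at every
  level.\<close>

lemma power2_sum_le_weighted: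
  fixes a b t :: real
  assumes "t > 0"
  shows "(a + b)\<^sup>2 \<le> (1 + t) * (a\<^sup>2 + b\<^sup>2 / t)"
proof -
  have "(1 + t) * (a\<^sup>2 + b\<^sup>2 / t) - (a + b)\<^sup>2 = (t * a - b)\<^sup>2 / t"
    using assms by (simp add: field_simps power2_eq_square)
  moreover have "\<dots> \<ge> 0"
    using assms by simp
  ultimately show ?thesis
    by linarith
qed

text \<open>An initial segment splits into at most \<open>r + 1\<close> of the pieces counted by the
  energy: at most one left half per level and one final single term. Cauchy-Schwarz then costs the
  factor \<open>r + 1\<close>. The right-hand side does not depend on \<open>k\<close>, so it bounds
  the maximum over all \<open>k\<close>.\<close>

lemma block_sum_le_dyadic_energy:
  assumes "k \<le> 2 ^ r"
  shows "(\<Sum>i\<in>{m..<m + k}. x i)\<^sup>2 \<le> (real r + 1) * dyadic_energy x r m"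
  using assms
proof (induction r arbitrary: m k)
  case 0
  then have "k = 0 \<or> k = 1" by auto
  then show ?case by auto
next
  case (Suc r)
  show ?case
  proof (cases "k \<le> 2 ^ r")
    case True
    have "(\<Sum>i\<in>{m..<m + k}. x i)\<^sup>2 \<le> (real r + 1) * dyadic_energy x r m"
      by (rule Suc.IH[OF True])
    also have "\<dots> \<le> (real (Suc r) + 1) * dyadic_energy x (Suc r) m"
      by (intro mult_mono) (auto simp: dyadic_energy_nonneg)
    finally show ?thesis .
  next
    case False
    define a where "a = (\<Sum>i\<in>{m..<m + 2 ^ r}. x i)"
    define b where "b = (\<Sum>i\<in>{m + 2 ^ r..<m + 2 ^ r + (k - 2 ^ r)}. x i)"
    have "b\<^sup>2 \<le> (real r + 1) * dyadic_energy x r (m + 2 ^ r)"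
      unfolding b_def using Suc.prems by (intro Suc.IH) auto
    then have b: "b\<^sup>2 / (real r + 1) \<le> dyadic_energy x r (m + 2 ^ r)"
      by (simp add: field_simps)
    have "(\<Sum>i\<in>{m..<m + k}. x i) = a + b"
      unfolding a_def b_def using False by (subst sum.atLeastLessThan_concat) auto
    \<comment> \<open>The weight \<open>t = r + 1\<close> cancels the factor that the induction
      hypothesis puts on \<open>b\<^sup>2\<close>, and \<open>1 + t\<close> is the factor required
      for \<open>Suc r\<close>.\<close>
    then have "(\<Sum>i\<in>{m..<m + k}. x i)\<^sup>2 \<le> (1 + (real r + 1)) * (a\<^sup>2 + b\<^sup>2 / (real r + 1))"
      using power2_sum_le_weighted[of "real r + 1" a b] by simp
    also have "\<dots> \<le> (1 + (real r + 1)) * dyadic_energy x (Suc r) m"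
      using b dyadic_energy_nonneg[of x r m] by (intro mult_left_mono) (auto simp: a_def)
    finally show ?thesis by (simp add: add_ac)
  qed
qed

lemma integrable_dyadic_energy:
  fixes Y :: "nat \<Rightarrow> 'a \<Rightarrow> real"
  assumes "\<And>m n. integrable M (\<lambda>\<omega>. (\<Sum>i\<in>{m..<m + n}. Y i \<omega>)\<^sup>2)"
  shows "integrable M (\<lambda>\<omega>. dyadic_energy (\<lambda>i. Y i \<omega>) r m)"
proof (induction r arbitrary: m)
  case 0
  show ?case using assms[of m 1] by simp
next
  case (Suc r)
  then show ?case using assms by simp
qed

text \<open>At each of the \<open>r + 1\<close> levels the counted blocks are disjoint and cover at
  most \<open>2 ^ r\<close> indices, so a level contributes at most
  \<open>C * 2 ^ r\<close>.\<close>

lemma integral_dyadic_energy_le: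
  fixes Y :: "nat \<Rightarrow> 'a \<Rightarrow> real"
  assumes int: "\<And>m n. integrable M (\<lambda>\<omega>. (\<Sum>i\<in>{m..<m + n}. Y i \<omega>)\<^sup>2)"
    and le: "\<And>m n. (\<integral>\<omega>. (\<Sum>i\<in>{m..<m + n}. Y i \<omega>)\<^sup>2 \<partial>M) \<le> C * real n"
  shows "(\<integral>\<omega>. dyadic_energy (\<lambda>i. Y i \<omega>) r m \<partial>M) \<le> C * 2 ^ r * (real r + 1)"
proof (induction r arbitrary: m)
  case 0
  show ?case using le[of m 1] by simp
next
  case (Suc r)
  \<comment> \<open>The recursion yields the factor \<open>2 * r + 3\<close> on
    \<open>C * 2 ^ r\<close> where the claim has \<open>2 * r + 4\<close>; the sign of
    \<open>C * 2 ^ r\<close> closes this gap.\<close>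
  have "0 \<le> (\<integral>\<omega>. (\<Sum>i\<in>{m..<m + 2 ^ r}. Y i \<omega>)\<^sup>2 \<partial>M)" by simp
  also have "\<dots> \<le> C * 2 ^ r" using le[of m "2 ^ r"] by simp
  finally have "0 \<le> C * 2 ^ r" .
  moreover have "(\<integral>\<omega>. dyadic_energy (\<lambda>i. Y i \<omega>) (Suc r) m \<partial>M) =
      (\<integral>\<omega>. (\<Sum>i\<in>{m..<m + 2 ^ r}. Y i \<omega>)\<^sup>2 \<partial>M) + (\<integral>\<omega>. dyadic_energy (\<lambda>i. Y i \<omega>) r m \<partial>M) +
      (\<integral>\<omega>. dyadic_energy (\<lambda>i. Y i \<omega>) r (m + 2 ^ r) \<partial>M)"
    by (simp add: int integrable_dyadic_energy)
  ultimately show ?case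
    using le[of m "2 ^ r"] Suc.IH[of m] Suc.IH[of "m + 2 ^ r"] by (simp add: algebra_simps)
qed

section \<open>Almost sure growth of partial sums\<close>

text \<open>By monotone convergence the sum of all \<open>f r\<close> has a finite integral, so it
  is finite almost everywhere; as the terms are nonnegative, it bounds each of them. This takes the
  place of Markov's inequality with Borel-Cantelli.\<close>

lemma AE_bounded_of_summable_integrals:
  fixes f :: "nat \<Rightarrow> 'a \<Rightarrow> real"
  assumes "\<And>r. integrable M (f r)" "\<And>r \<omega>. 0 \<le> f r \<omega>"
    and "\<And>r. integral\<^sup>L M (f r) \<le> b r" "summable b"
  shows "AE \<omega> in M. \<exists>K. \<forall>r. f r \<omega> \<le> K"
proof -
  have meas [measurable]: "f r \<in> borel_measurable M" for r
    using assms(1) by blast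
  have b: "0 \<le> b r" for r
    using assms(3)[of r] Bochner_Integration.integral_nonneg[of M "f r"] assms(2) by (smt (verit))
  have "(\<integral>\<^sup>+\<omega>. (\<Sum>r. ennreal (f r \<omega>)) \<partial>M) = (\<Sum>r. \<integral>\<^sup>+\<omega>. ennreal (f r \<omega>) \<partial>M)"
    by (intro nn_integral_suminf) simp
  also have "\<dots> = (\<Sum>r. ennreal (integral\<^sup>L M (f r)))"
    by (intro suminf_cong nn_integral_eq_integral assms(1)) (simp add: assms(2))
  also have "\<dots> \<le> (\<Sum>r. ennreal (b r))"
    by (intro suminf_le ennreal_leI assms(3)) simp_all
  also have "\<dots> = ennreal (\<Sum>r. b r)"
    by (intro suminf_ennreal2 b assms(4))
  also have "\<dots> < \<infinity>" by simp
  finally have "AE \<omega> in M. (\<Sum>r. ennreal (f r \<omega>)) \<noteq> \<infinity>"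
    by (intro nn_integral_PInf_AE) auto
  then show ?thesis
  proof eventually_elim
    case (elim \<omega>)
    have "f r \<omega> \<le> enn2real (\<Sum>r. ennreal (f r \<omega>))" for r
    proof -
      have "(\<Sum>i\<in>{r}. ennreal (f i \<omega>)) \<le> (\<Sum>r. ennreal (f r \<omega>))"
        by (intro sum_le_suminf) auto
      then have "enn2real (ennreal (f r \<omega>)) \<le> enn2real (\<Sum>r. ennreal (f r \<omega>))"
        using elim by (intro enn2real_mono) (auto simp: top.not_eq_extremum)
      then show ?thesis using assms(2) by simp
    qed
    then show ?case by blast
  qed
qed

lemma exists_power2_between:
  assumes "n \<ge> (1 :: nat)"
  shows "\<exists>r. n \<le> 2 ^ r \<and> 2 ^ r \<le> 2 * n"
  using assms
proof (induction n rule: nat_induct_at_least)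
  case base
  show ?case by (intro exI[of _ 0]) auto
next
  case (Suc n)
  then obtain r where r: "n \<le> 2 ^ r" "2 ^ r \<le> 2 * n" by blast
  show ?case
  proof (cases "n = 2 ^ r")
    case True
    then show ?thesis by (intro exI[of _ "Suc r"]) auto
  next
    case False
    then show ?thesis using r by (intro exI[of _ r]) auto
  qed
qed

text \<open>At scale \<open>2 ^ r\<close> the maximal squared sum has expectation at most
  \<open>C * (r + 1)\<^sup>2 * 2 ^ r\<close>. Division by the weight \<open>w r\<close> leaves a
  polynomial over \<open>(2 powr \<epsilon>) ^ r\<close>, which is summable.\<close>

lemma AE_partial_sums_power2_le:
  fixes Y :: "nat \<Rightarrow> 'a \<Rightarrow> real"
  assumes int: "\<And>m n. integrable M (\<lambda>\<omega>. (\<Sum>i\<in>{m..<m + n}. Y i \<omega>)\<^sup>2)"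
    and le: "\<And>m n. (\<integral>\<omega>. (\<Sum>i\<in>{m..<m + n}. Y i \<omega>)\<^sup>2 \<partial>M) \<le> C * real n"
    and "\<epsilon> > 0"
  shows "AE \<omega> in M. \<exists>K. \<forall>n\<ge>1. (\<Sum>i<n. Y i \<omega>)\<^sup>2 \<le> K * real n powr (1 + \<epsilon>)"
proof -
  define w where "w r = (2 ^ r) powr (1 + \<epsilon>)" for r :: nat
  define f where "f r \<omega> = (real r + 1) * dyadic_energy (\<lambda>i. Y i \<omega>) r 0 / w r" for r \<omega>
  define b where "b r = C * ((real r + 1)\<^sup>2 / (2 powr \<epsilon>) ^ r)" for r
  have w: "w r > 0" for r by (simp add: w_def)
  have w_eq: "w r = 2 ^ r * (2 powr \<epsilon>) ^ r" for r
    by (simp add: w_def powr_add powr_powr powr_realpow[symmetric] mult.commute)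
  have "integral\<^sup>L M (f r) \<le> b r" for r
  proof -
    have "integral\<^sup>L M (f r) = (real r + 1) / w r * (\<integral>\<omega>. dyadic_energy (\<lambda>i. Y i \<omega>) r 0 \<partial>M)"
      by (simp add: f_def[abs_def])
    also have "\<dots> \<le> (real r + 1) / w r * (C * 2 ^ r * (real r + 1))"
      using w[of r] by (intro mult_left_mono integral_dyadic_energy_le int le) auto
    also have "\<dots> = b r"
      by (simp add: w_eq b_def power2_eq_square)
    finally show ?thesis .
  qed
  moreover have "summable b"
  proof -
    have q: "2 powr \<epsilon> > 1"
      using \<open>\<epsilon> > 0\<close> by simp
    \<comment> \<open>Geometric decay beats any power of \<open>r\<close>; the base
      \<open>2 powr \<epsilon>\<close> is abstracted to a constant \<open>q > 1\<close>.\<close>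
    have "(\<lambda>r. (real r + 1)\<^sup>2 / q ^ r) \<in> O(\<lambda>r. inverse (real r ^ 2))" if "q > 1" for q :: real
      using that by real_asymp
    from this[OF q] have "summable (\<lambda>r. (real r + 1)\<^sup>2 / (2 powr \<epsilon>) ^ r)"
      by (rule summable_comparison_test_bigo[rotated])
        (use inverse_power_summable[of 2, where 'a = real] in simp)
    then show ?thesis
      unfolding b_def by (rule summable_mult)
  qed
  moreover have "integrable M (f r)" for r
    unfolding f_def by (simp add: integrable_dyadic_energy int)
  moreover have "0 \<le> f r \<omega>" for r \<omega>
    using w[of r] by (simp add: f_def dyadic_energy_nonneg)
  ultimately have "AE \<omega> in M. \<exists>K. \<forall>r. f r \<omega> \<le> K"
    by (intro AE_bounded_of_summable_integrals[where b = b])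
  then show ?thesis
  proof eventually_elim
    case (elim \<omega>)
    then obtain K where K: "f r \<omega> \<le> K" for r by blast
    \<comment> \<open>The sign of \<open>K\<close> is what allows \<open>w r\<close> to be enlarged
      under the factor \<open>K\<close> below.\<close>
    have "0 \<le> f 0 \<omega>"
      by (simp add: f_def w_def)
    then have K0: "0 \<le> K" using K[of 0] by simp
    have "(\<Sum>i<n. Y i \<omega>)\<^sup>2 \<le> K * 2 powr (1 + \<epsilon>) * real n powr (1 + \<epsilon>)" if "n \<ge> 1" for n
    proof -
      \<comment> \<open>The upper bound on \<open>2 ^ r\<close> turns the weight at scale
        \<open>r\<close> into a power of \<open>n\<close>, at the cost of the constant
        \<open>2 powr (1 + \<epsilon>)\<close>.\<close>
      obtain r where r: "n \<le> 2 ^ r" "2 ^ r \<le> 2 * n"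
        using exists_power2_between[OF \<open>n \<ge> 1\<close>] by blast
      have "(\<Sum>i<n. Y i \<omega>)\<^sup>2 \<le> (real r + 1) * dyadic_energy (\<lambda>i. Y i \<omega>) r 0"
        using block_sum_le_dyadic_energy[OF r(1), of "\<lambda>i. Y i \<omega>" 0]
        by (simp add: atLeast0LessThan)
      also have "\<dots> \<le> K * w r"
        using K[of r] w[of r] by (simp add: f_def field_simps)
      also have "\<dots> \<le> K * (2 * real n) powr (1 + \<epsilon>)"
      proof -
        have "real (2 ^ r) \<le> real (2 * n)"
          using r(2) by (rule of_nat_mono)
        then show ?thesis
          unfolding w_def using \<open>\<epsilon> > 0\<close> by (intro mult_left_mono powr_mono2 K0) auto
      qed
      finally show ?thesis
        by (simp add: powr_mult mult.assoc)
    qed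
    then show ?case by blast
  qed
qed

section \<open>Second moments of block sums under weak dependence\<close>

lemma l1_coordinate:
  shows "l1_lipschitz {i} (\<lambda>x. x i)"
    and "0 \<le> l1_lip_norm {i} (\<lambda>x. x i)"
    and "l1_lip_norm {i} (\<lambda>x. x i) \<le> 1"
proof -
  let ?A = "insert 0 {\<bar>x i - y i\<bar> / l1_dist {i} x y | x y.
              x \<in> {i} \<rightarrow>\<^sub>E (UNIV :: real set) \<and> y \<in> {i} \<rightarrow>\<^sub>E UNIV \<and> x \<noteq> y}"
  show "l1_lipschitz {i} (\<lambda>x. x i)"
    unfolding l1_lipschitz_def l1_dist_def by (intro exI[of _ 1]) auto
  \<comment> \<open>On a singleton index set the distance is \<bar>\<open>x i - y i\<close>\<bar>
    itself, so no quotient exceeds 1.\<close>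
  have le: "a \<le> 1" if "a \<in> ?A" for a
    using that by (auto simp: l1_dist_def divide_simps)
  show "0 \<le> l1_lip_norm {i} (\<lambda>x. x i)"
    unfolding l1_lip_norm_def by (rule cSup_upper) (auto intro!: bdd_aboveI[of _ 1] le)
  show "l1_lip_norm {i} (\<lambda>x. x i) \<le> 1"
    unfolding l1_lip_norm_def by (rule cSup_least) (auto intro!: le)
qed

text \<open>The definition is applied to singletons and coordinate functions, whose Lipschitz norms
  lie between 0 and 1; centring makes the covariance the expectation of the product.\<close>

lemma L_weakly_dependent_product:
  assumes dep: "L_weakly_dependent M X \<gamma>"
    and ij: "i \<ge> 1" "j \<ge> 1" "i \<noteq> j"
    and mean: "integral\<^sup>L M (X i) = 0" "integral\<^sup>L M (X j) = 0"
  shows "integrable M (\<lambda>\<omega>. X i \<omega> * X j \<omega>)"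
    and "(\<integral>\<omega>. X i \<omega> * X j \<omega> \<partial>M) \<le> \<gamma> (nat \<bar>int j - int i\<bar>)"
proof -
  let ?N = "\<lambda>k. l1_lip_norm {k} (\<lambda>x. x k)"
  have "covariance_defined M (X i) (X j) \<and>
      \<bar>covariance M (X i) (X j)\<bar> \<le> ?N i * ?N j * \<gamma> (nat \<bar>int j - int i\<bar>)"
    using dep[unfolded L_weakly_dependent_def, THEN conjunct2, THEN conjunct2,
        rule_format, of "{i}" "{j}" "\<lambda>x. x i" "\<lambda>x. x j"] ij l1_coordinate(1)
    by simp
  then have *: "covariance_defined M (X i) (X j)"
    "\<bar>covariance M (X i) (X j)\<bar> \<le> ?N i * ?N j * \<gamma> (nat \<bar>int j - int i\<bar>)"
    by auto
  from *(1) show "integrable M (\<lambda>\<omega>. X i \<omega> * X j \<omega>)"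
    by (simp add: covariance_defined_def)
  have "\<gamma> (nat \<bar>int j - int i\<bar>) \<ge> 0"
    using dep ij(3) unfolding L_weakly_dependent_def by auto
  moreover have "?N i * ?N j \<le> 1"
    by (intro mult_le_one l1_coordinate)
  ultimately have "?N i * ?N j * \<gamma> (nat \<bar>int j - int i\<bar>) \<le> \<gamma> (nat \<bar>int j - int i\<bar>)"
    using mult_right_mono by fastforce
  with *(2) show "(\<integral>\<omega>. X i \<omega> * X j \<omega> \<partial>M) \<le> \<gamma> (nat \<bar>int j - int i\<bar>)"
    by (simp add: covariance_def mean)
qed

text \<open>Each positive distance from \<open>i\<close> occurs at most once to the left and at most
  once to the right, hence the factor 2.\<close>

lemma sum_distances_le_suminf:
  fixes g :: "nat \<Rightarrow> real"
  assumes nonneg: "\<And>k. k \<ge> 1 \<Longrightarrow> 0 \<le> g k" and summ: "summable (\<lambda>k. g (Suc k))"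
    and fin: "finite A"
  shows "(\<Sum>j\<in>A - {i}. g (nat \<bar>int j - int i\<bar>)) \<le> 2 * (\<Sum>k. g (Suc k))"
proof -
  let ?d = "\<lambda>j. nat \<bar>int j - int i\<bar>"
  have half: "(\<Sum>j\<in>B. g (?d j)) \<le> (\<Sum>k. g (Suc k))"
    if B: "finite B" "inj_on ?d B" "i \<notin> B" for B
  proof -
    \<comment> \<open>The series starts at distance 1, so the reindexing is by distance minus one;
      this does not truncate because \<open>i\<close> is outside \<open>B\<close>.\<close>
    have "(\<Sum>j\<in>B. g (?d j)) = (\<Sum>j\<in>B. g (Suc (?d j - 1)))"
    proof (intro sum.cong refl)
      fix j assume "j \<in> B"
      with B(3) have "j \<noteq> i" by auto
      then have "?d j = Suc (?d j - 1)" by linarith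
      then show "g (?d j) = g (Suc (?d j - 1))" by (rule arg_cong[of _ _ g])
    qed
    also have "\<dots> = (\<Sum>k\<in>(\<lambda>j. ?d j - 1) ` B. g (Suc k))"
    proof (subst sum.reindex)
      show "inj_on (\<lambda>j. ?d j - 1) B"
      proof (rule inj_onI)
        fix x y assume xy: "x \<in> B" "y \<in> B" "?d x - 1 = ?d y - 1"
        moreover have "x \<noteq> i" "y \<noteq> i" using xy B(3) by auto
        ultimately have "?d x = ?d y" by linarith
        then show "x = y" using inj_onD[OF B(2)] xy by blast
      qed
    qed simp
    also have "\<dots> \<le> (\<Sum>k. g (Suc k))"
      by (intro sum_le_suminf summ) (use B nonneg in auto)
    finally show ?thesis .
  qed
  let ?L = "{j\<in>A. j < i}" and ?R = "{j\<in>A. j > i}"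
  have split: "A - {i} = ?L \<union> ?R" by auto
  have "(\<Sum>j\<in>A - {i}. g (?d j)) = (\<Sum>j\<in>?L. g (?d j)) + (\<Sum>j\<in>?R. g (?d j))"
    unfolding split by (rule sum.union_disjoint) (use fin in auto)
  also have "\<dots> \<le> (\<Sum>k. g (Suc k)) + (\<Sum>k. g (Suc k))"
  proof (intro add_mono half)
    show "inj_on ?d ?L" "inj_on ?d ?R"
      by (auto intro!: inj_onI)
  qed (use fin in auto)
  finally show ?thesis by simp
qed

lemma sum_power2_eq_double_sum:
  fixes x :: "'b \<Rightarrow> real"
  shows "(\<Sum>i\<in>A. x i)\<^sup>2 = (\<Sum>i\<in>A. \<Sum>j\<in>A. x i * x j)"
  by (simp add: power2_eq_square sum_product)

text \<open>Each row of the matrix of product moments sums to at most a constant: \<open>D\<close>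
  from the diagonal and twice the series from the rest. There are \<open>card A\<close>
  rows.\<close>

lemma integral_block_sum_le:
  fixes Y :: "nat \<Rightarrow> 'a \<Rightarrow> real"
  assumes int: "\<And>i j. integrable M (\<lambda>\<omega>. Y i \<omega> * Y j \<omega>)"
    and diag: "\<And>i. (\<integral>\<omega>. Y i \<omega> * Y i \<omega> \<partial>M) \<le> D"
    and off: "\<And>i j. i \<noteq> j \<Longrightarrow> (\<integral>\<omega>. Y i \<omega> * Y j \<omega> \<partial>M) \<le> g (nat \<bar>int j - int i\<bar>)"
    and nonneg: "\<And>k. k \<ge> 1 \<Longrightarrow> 0 \<le> g k" and summ: "summable (\<lambda>k. g (Suc k))"
    and fin: "finite A"
  shows "(\<integral>\<omega>. (\<Sum>i\<in>A. Y i \<omega>)\<^sup>2 \<partial>M) \<le> (D + 2 * (\<Sum>k. g (Suc k))) * real (card A)"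
proof -
  have "(\<integral>\<omega>. (\<Sum>i\<in>A. Y i \<omega>)\<^sup>2 \<partial>M) = (\<Sum>i\<in>A. \<Sum>j\<in>A. \<integral>\<omega>. Y i \<omega> * Y j \<omega> \<partial>M)"
    by (simp add: sum_power2_eq_double_sum int Bochner_Integration.integral_sum)
  also have "\<dots> \<le> (\<Sum>i\<in>A. D + 2 * (\<Sum>k. g (Suc k)))"
  proof (rule sum_mono)
    fix i assume "i \<in> A"
    then have "(\<Sum>j\<in>A. \<integral>\<omega>. Y i \<omega> * Y j \<omega> \<partial>M) =
        (\<integral>\<omega>. Y i \<omega> * Y i \<omega> \<partial>M) + (\<Sum>j\<in>A - {i}. \<integral>\<omega>. Y i \<omega> * Y j \<omega> \<partial>M)"
      using fin by (simp add: sum.remove)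
    also have "\<dots> \<le> D + (\<Sum>j\<in>A - {i}. g (nat \<bar>int j - int i\<bar>))"
      by (intro add_mono diag sum_mono off) auto
    also have "\<dots> \<le> D + 2 * (\<Sum>k. g (Suc k))"
      by (intro add_mono order.refl sum_distances_le_suminf nonneg summ fin)
    finally show "(\<Sum>j\<in>A. \<integral>\<omega>. Y i \<omega> * Y j \<omega> \<partial>M) \<le> D + 2 * (\<Sum>k. g (Suc k))" .
  qed
  finally show ?thesis by (simp add: mult.commute)
qed

section \<open>Convergence rate of the averages\<close>

lemma average_bigo_of_power2_bound:
  fixes s :: "nat \<Rightarrow> real"
  assumes "\<And>n. n \<ge> 1 \<Longrightarrow> (s n)\<^sup>2 \<le> K * real n powr (1 + 2 * \<delta>)"
  shows "(\<lambda>n. s n / real n) \<in> O(\<lambda>n. ln (real n) / real n powr (1/2 - \<delta>))"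
proof -
  have "(\<lambda>n. s n / real n) \<in> O(\<lambda>n. 1 / real n powr (1/2 - \<delta>))"
  proof (rule bigoI)
    show "\<forall>\<^sub>F n in sequentially. norm (s n / real n) \<le> sqrt K * norm (1 / real n powr (1/2 - \<delta>))"
      using eventually_ge_at_top[of 1]
    proof eventually_elim
      case (elim n)
      have "\<bar>s n\<bar> \<le> sqrt (K * real n powr (1 + 2 * \<delta>))"
        using assms[OF elim] by (rule real_le_rsqrt[of "\<bar>s n\<bar>", simplified])
      also have "\<dots> = sqrt K * real n powr (1/2 + \<delta>)"
        using elim by (simp add: real_sqrt_mult powr_half_sqrt[symmetric] powr_powr add_divide_distrib)
      finally have "\<bar>s n\<bar> / real n \<le> sqrt K * (real n powr (1/2 + \<delta>) / real n)"
        using elim by (simp add: divide_simps)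
      also have "real n powr (1/2 + \<delta>) / real n = real n powr (1/2 + \<delta> - 1)"
        using elim powr_diff[of "real n" "1/2 + \<delta>" 1] by simp
      also have "\<dots> = 1 / real n powr (1/2 - \<delta>)"
        by (simp add: powr_minus_divide[symmetric])
      finally show ?case by simp
    qed
  qed
  \<comment> \<open>The bound holds without the logarithm; inserting it only weakens the claim,
    since \<open>ln n\<close> is eventually at least 1.\<close>
  also have "(\<lambda>n. 1 / real n powr (1/2 - \<delta>)) \<in> O(\<lambda>n. ln (real n) / real n powr (1/2 - \<delta>))"
    by real_asymp
  finally show ?thesis .
qed

theorem theorem12:
  fixes M :: "'a measure"
    and X :: "nat \<Rightarrow> 'a \<Rightarrow> real"
    and S :: "nat \<Rightarrow> 'a \<Rightarrow> real"
    and \<gamma> :: "nat \<Rightarrow> real"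
    and c \<sigma> \<rho> :: real
  assumes "prob_space M"
    and "\<And>n. n \<ge> 1 \<Longrightarrow> X n \<in> borel_measurable M"
    and "strictly_stationary M X"
    and "\<And>n. n \<ge> 1 \<Longrightarrow> integrable M (X n) \<and> integral\<^sup>L M (X n) = 0"
    and "L_weakly_dependent M X \<gamma>"
    and "c > 0"
    and "\<And>n. n \<ge> 1 \<Longrightarrow> AE \<omega> in M. \<bar>X n \<omega>\<bar> \<le> c"
    and "\<And>n \<omega>. S n \<omega> = (\<Sum>k=1..n. X k \<omega>)"
    and "\<sigma>\<^sup>2 > 0"
    and "(\<lambda>n. integral\<^sup>L M (\<lambda>\<omega>. (S n \<omega>)\<^sup>2) / real n) \<longlonglongrightarrow> \<sigma>\<^sup>2"
    and "0 < \<rho>" and "\<rho> < 1"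
    and "(\<lambda>n. \<Sum>k. \<gamma> (n + k)) \<in> O(\<lambda>n. \<rho> ^ n)"
  shows "(AE \<omega> in M. (\<lambda>n. S n \<omega> / real n) \<longlonglongrightarrow> 0) \<and>
    (\<forall>\<delta>>0. AE \<omega> in M.
        (\<lambda>n. S n \<omega> / real n) \<in> O(\<lambda>n. ln (real n) / real n powr (1/2 - \<delta>)))"
proof -
  interpret prob_space M by fact
  \<comment> \<open>The shift to index 0 makes every block \<open>{m..<m + n}\<close> admissible and
    keeps \<open>X 0\<close>, about which nothing is assumed, out of the sums.\<close>
  define Y where "Y i = X (Suc i)" for i
  have dep: "L_weakly_dependent M X \<gamma>" by fact
  have nonneg: "0 \<le> \<gamma> k" if "k \<ge> 1" for k
    using dep that by (simp add: L_weakly_dependent_def)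
  have summ: "summable (\<lambda>k. \<gamma> (Suc k))"
    using dep by (simp add: L_weakly_dependent_def)
  have [measurable]: "Y i \<in> borel_measurable M" for i
    unfolding Y_def by (rule assms(2)) simp
  have bound: "AE \<omega> in M. \<bar>Y i \<omega> * Y i \<omega>\<bar> \<le> c\<^sup>2" for i
    using assms(7)[of "Suc i", simplified]
    by eventually_elim (simp add: Y_def power2_eq_square[symmetric] abs_le_square_iff[symmetric])
  have int_diag: "integrable M (\<lambda>\<omega>. Y i \<omega> * Y i \<omega>)" for i
    by (rule integrable_const_bound[of _ "c\<^sup>2"]) (use bound in auto)
  have diag: "(\<integral>\<omega>. Y i \<omega> * Y i \<omega> \<partial>M) \<le> c\<^sup>2" for i
  proof -
    have "(\<integral>\<omega>. Y i \<omega> * Y i \<omega> \<partial>M) \<le> (\<integral>\<omega>. c\<^sup>2 \<partial>M)"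
      by (rule integral_mono_AE) (use bound[of i] int_diag in auto)
    then show ?thesis by (simp add: prob_space)
  qed
  have mean: "integral\<^sup>L M (X (Suc i)) = 0" for i
    using assms(4)[of "Suc i"] by simp
  \<comment> \<open>Weak dependence concerns disjoint index sets only, so the diagonal products are
    handled by the bound \<open>c\<close> instead.\<close>
  have int: "integrable M (\<lambda>\<omega>. Y i \<omega> * Y j \<omega>)" for i j
    using int_diag L_weakly_dependent_product(1)[OF dep, of "Suc i" "Suc j"]
    by (cases "i = j") (auto simp: Y_def mean)
  have off: "(\<integral>\<omega>. Y i \<omega> * Y j \<omega> \<partial>M) \<le> \<gamma> (nat \<bar>int j - int i\<bar>)" if "i \<noteq> j" for i j
    using L_weakly_dependent_product(2)[OF dep, of "Suc i" "Suc j"] that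
    by (simp add: Y_def mean)
  have block_int: "integrable M (\<lambda>\<omega>. (\<Sum>i\<in>{m..<m + n}. Y i \<omega>)\<^sup>2)" for m n
    by (simp add: sum_power2_eq_double_sum int)
  have block_le: "(\<integral>\<omega>. (\<Sum>i\<in>{m..<m + n}. Y i \<omega>)\<^sup>2 \<partial>M)
      \<le> (c\<^sup>2 + 2 * (\<Sum>k. \<gamma> (Suc k))) * real n" for m n
    using integral_block_sum_le[OF int diag off nonneg summ, of "{m..<m + n}"] by simp
  have S: "S n \<omega> = (\<Sum>i<n. Y i \<omega>)" for n \<omega>
    by (simp add: assms(8) Y_def sum.atLeast1_atMost_eq)
  have rate: "AE \<omega> in M. (\<lambda>n. S n \<omega> / real n) \<in> O(\<lambda>n. ln (real n) / real n powr (1/2 - \<delta>))"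
    if "\<delta> > 0" for \<delta>
  proof -
    \<comment> \<open>With \<open>\<epsilon> = 2 * \<delta>\<close>, taking the square root and
      dividing by \<open>n\<close> gives exactly the exponent \<open>\<delta> - 1/2\<close>.\<close>
    have "AE \<omega> in M. \<exists>K. \<forall>n\<ge>1. (\<Sum>i<n. Y i \<omega>)\<^sup>2 \<le> K * real n powr (1 + 2 * \<delta>)"
      by (rule AE_partial_sums_power2_le[OF block_int block_le]) (use that in simp)
    then show ?thesis
    proof eventually_elim
      case (elim \<omega>)
      then obtain K where "(S n \<omega>)\<^sup>2 \<le> K * real n powr (1 + 2 * \<delta>)" if "n \<ge> 1" for n
        unfolding S by blast
      then show ?case by (rule average_bigo_of_power2_bound)
    qed
  qed
  \<comment> \<open>Any \<open>\<delta>\<close> below 1/2 makes the rate tend to 0; 1/4 is one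
    choice.\<close>
  have "AE \<omega> in M. (\<lambda>n. S n \<omega> / real n) \<longlonglongrightarrow> 0"
    using rate[of "1/4", simplified]
  proof eventually_elim
    case (elim \<omega>)
    moreover have "(\<lambda>n. ln (real n) / real n powr (1/4)) \<in> o(\<lambda>_. 1)"
      by real_asymp
    ultimately have "(\<lambda>n. S n \<omega> / real n) \<in> o(\<lambda>_. 1)"
      by (rule landau_o.big_small_trans)
    then show ?case by (auto dest: smalloD_tendsto)
  qed
  with rate show ?thesis by blast
qed

end
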